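(* Let $\mathcal{U} = \{U_1, \ldots, U_n\}$ and $\mathcal{V} = \{V_1, \ldots, V_n\}$ be (ordered) collections of (not necessarily open, closed, or convex) sets in $\mathbb{R}^{d_1}$ and $\mathbb{R}^{d_2}$ respectively. Define $\mathcal{W} = \{W_1,\ldots, W_n\}$, a collection of sets in $\mathbb{R}^{d_1+d_2}$, where $W_i = U_i\times V_i$ for each $i$. Then $$\operatorname{code}(\mathcal{W}) = \operatorname{code}(\mathcal{U}) \sqcap \operatorname{code}(\mathcal{V}).$$
   Context: Write $[n]=\{1,\ldots,n\}$. A code is a set $\mathcal{C}\subseteq 2^{[n]}$ of subsets of $[n]$. For an ordered (indexed) collection $\mathcal{U} = \{U_1, \ldots, U_n\}$ of sets in $\mathbb{R}^d$, its code is $$\operatorname{code}(\mathcal{U}) = \{\sigma\subseteq [n] \mid \text{there exists } p\in \mathbb{R}^d \text{ such that for all } i\in[n],\ p\in U_i \text{ if and only if } i\in\sigma\}.$$ The intersection product of two codes $\mathcal{C},\mathcal{D}\subseteq 2^{[n]}$ is $\mathcal{C} \sqcap \mathcal{D} = \{ c_1 \cap c_2 \mid c_1\in \mathcal{C} \text{ and } c_2\in \mathcal{D}\}$. *)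

theory Defs
  imports Jordan_Normal_Form.Matrix
begin

text \<open>The space \<open>\<real>\<^sup>d\<close> is \<open>carrier_vec d :: real vec set\<close>, for an arbitrary natural number
  \<open>d\<close> (including \<open>0\<close>). A collection indexed by \<open>[n] = {1..n}\<close> is a function on \<open>nat\<close> of which
  only the values at the indices \<open>1..n\<close> matter.\<close>

definition collection_in :: "nat \<Rightarrow> nat \<Rightarrow> (nat \<Rightarrow> real vec set) \<Rightarrow> bool" where
  "collection_in d n U \<longleftrightarrow> (\<forall>i\<in>{1..n}. U i \<subseteq> carrier_vec d)"

definition code_of :: "nat \<Rightarrow> nat \<Rightarrow> (nat \<Rightarrow> real vec set) \<Rightarrow> nat set set" where
  "code_of d n U =
     {\<sigma>. \<sigma> \<subseteq> {1..n} \<and> (\<exists>p\<in>carrier_vec d. \<forall>i\<in>{1..n}. p \<in> U i \<longleftrightarrow> i \<in> \<sigma>)}"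

definition inter_product :: "nat set set \<Rightarrow> nat set set \<Rightarrow> nat set set"  (infixl "\<sqinter>\<^sub>c" 70) where
  "C \<sqinter>\<^sub>c D = {c1 \<inter> c2 | c1 c2. c1 \<in> C \<and> c2 \<in> D}"

text \<open>The product of a subset of \<open>\<real>\<^sup>d\<close> and a subset of \<open>\<real>\<^sup>e\<close>, as a subset of \<open>\<real>\<^sup>d\<^sup>+\<^sup>e\<close>: pairs
  \<open>(u, v)\<close> are identified with the concatenated coordinate vectors.\<close>

definition vec_prod :: "real vec set \<Rightarrow> real vec set \<Rightarrow> real vec set"  (infixr "\<times>\<^sub>v" 80) where
  "A \<times>\<^sub>v B = {u @\<^sub>v v | u v. u \<in> A \<and> v \<in> B}"

end

theory Submission
  imports Defs
begin

text \<open>A point of the product space is a pair of points \<open>p\<close>, \<open>q\<close>, and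
  it lies in \<open>W i\<close> exactly when \<open>p\<close> lies in \<open>U i\<close> and
  \<open>q\<close> in \<open>V i\<close>; so its codeword is the intersection of the codewords of
  \<open>p\<close> and \<open>q\<close>. As \<open>p\<close> and \<open>q\<close> vary
  independently, these intersections are exactly the elements of the intersection product. With
  pairs encoded as concatenated vectors, the content lies in unique splitting
  (\<open>append_vec_mem_vec_prod_iff\<close>) and existence of a splitting
  (\<open>carrier_vec_add_eq\<close>).\<close>

text \<open>Each point realizes exactly one codeword, so the code is the image of the space under a
  map from points to codewords.\<close>

lemma code_of_eq_image:
  "code_of d n U = (\<lambda>p. {i\<in>{1..n}. p \<in> U i}) ` carrier_vec d"
proof -
  have "\<sigma> \<subseteq> {1..n} \<and> (\<forall>i\<in>{1..n}. p \<in> U i \<longleftrightarrow> i \<in> \<sigma>) \<longleftrightarrow> \<sigma> = {i\<in>{1..n}. p \<in> U i}" for \<sigma> p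
    by blast
  then show ?thesis
    unfolding code_of_def image_def by (simp flip: bex_simps)
qed

text \<open>A concatenation can be cut at several places; it determines its two parts only once the
  length of the first is fixed. Here \<open>p\<close> and all elements of \<open>A\<close> have
  length \<open>d\<close>.\<close>

lemma append_vec_mem_vec_prod_iff:
  assumes "p \<in> carrier_vec d" "A \<subseteq> carrier_vec d"
  shows "p @\<^sub>v q \<in> A \<times>\<^sub>v B \<longleftrightarrow> p \<in> A \<and> q \<in> B"
proof
  assume "p @\<^sub>v q \<in> A \<times>\<^sub>v B"
  then obtain u v where uv: "p @\<^sub>v q = u @\<^sub>v v" "u \<in> A" "v \<in> B"
    unfolding vec_prod_def by auto
  moreover have "u \<in> carrier_vec d"
    using assms(2) uv(2) by (rule subsetD)
  ultimately show "p \<in> A \<and> q \<in> B"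
    using append_vec_eq[OF assms(1)] by simp
next
  assume "p \<in> A \<and> q \<in> B"
  then show "p @\<^sub>v q \<in> A \<times>\<^sub>v B"
    unfolding vec_prod_def by auto
qed

text \<open>Cutting a vector after its first \<open>d\<close> coordinates exhibits it as a pair, so
  every point of the product space has the form needed to read off its codeword.\<close>

lemma carrier_vec_add_eq:
  "carrier_vec (d + e) = {p @\<^sub>v q | p q. p \<in> carrier_vec d \<and> q \<in> carrier_vec e}"
proof (intro equalityI subsetI)
  fix x :: "'a vec"
  assume "x \<in> carrier_vec (d + e)"
  then have "x = vec_first x d @\<^sub>v vec_last x e"
    by simp
  then show "x \<in> {p @\<^sub>v q | p q. p \<in> carrier_vec d \<and> q \<in> carrier_vec e}"
    by (intro CollectI exI conjI) (assumption, rule vec_first_carrier, rule vec_last_carrier)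
qed auto

theorem theorem3:
  fixes n d1 d2 :: nat
    and U V W :: "nat \<Rightarrow> real vec set"
  assumes "collection_in d1 n U"
    and "collection_in d2 n V"
    and "\<And>i. i \<in> {1..n} \<Longrightarrow> W i = U i \<times>\<^sub>v V i"
  shows "code_of (d1 + d2) n W = code_of d1 n U \<sqinter>\<^sub>c code_of d2 n V"
proof -
  have codeword: "{i\<in>{1..n}. p @\<^sub>v q \<in> W i} = {i\<in>{1..n}. p \<in> U i} \<inter> {i\<in>{1..n}. q \<in> V i}"
    if "p \<in> carrier_vec d1" for p q
  proof -
    have "p @\<^sub>v q \<in> W i \<longleftrightarrow> p \<in> U i \<and> q \<in> V i" if "i \<in> {1..n}" for i
      using append_vec_mem_vec_prod_iff[OF \<open>p \<in> carrier_vec d1\<close>] assms(1,3) that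
      unfolding collection_in_def by simp
    then show ?thesis
      by blast
  qed
  show ?thesis
  proof (intro equalityI subsetI)
    fix c
    assume "c \<in> code_of (d1 + d2) n W"
    then obtain p q where pq: "p \<in> carrier_vec d1" "q \<in> carrier_vec d2"
      and "c = {i\<in>{1..n}. p @\<^sub>v q \<in> W i}"
      unfolding code_of_eq_image carrier_vec_add_eq by auto
    then have "c = {i\<in>{1..n}. p \<in> U i} \<inter> {i\<in>{1..n}. q \<in> V i}"
      by (simp only: codeword)
    moreover have "{i\<in>{1..n}. p \<in> U i} \<in> code_of d1 n U" "{i\<in>{1..n}. q \<in> V i} \<in> code_of d2 n V"
      unfolding code_of_eq_image by (rule imageI, fact pq)+
    ultimately show "c \<in> code_of d1 n U \<sqinter>\<^sub>c code_of d2 n V"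
      unfolding inter_product_def by blast
  next
    fix c
    assume "c \<in> code_of d1 n U \<sqinter>\<^sub>c code_of d2 n V"
    \<comment> \<open>The two factors of \<open>c\<close> are realized by unrelated points
      \<open>p\<close> and \<open>q\<close>; the single point \<open>p @\<^sub>v q\<close> then
      realizes their intersection.\<close>
    then obtain p q where pq: "p \<in> carrier_vec d1" "q \<in> carrier_vec d2"
      and "c = {i\<in>{1..n}. p \<in> U i} \<inter> {i\<in>{1..n}. q \<in> V i}"
      unfolding code_of_eq_image inter_product_def by auto
    then have "c = {i\<in>{1..n}. p @\<^sub>v q \<in> W i}"
      by (simp only: codeword)
    moreover have "p @\<^sub>v q \<in> carrier_vec (d1 + d2)"
      using pq by simp
    ultimately show "c \<in> code_of (d1 + d2) n W"
      unfolding code_of_eq_image by (rule image_eqI)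
  qed
qed

end
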